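(* Let $(p_{k,l})_{-1\le k,l\le 1}$ be nonnegative numbers with $\sum_{k,l}p_{k,l}=1$, and let $(X,Y)$ be a Markov chain on $\mathbb{Z}_+^2$ which, from every state $(i,j)$ with $i,j\ge1$, jumps to $(i+k,j+l)$ with probability $p_{k,l}$. Assume (H2) in the list $p_{1,1},p_{1,0},p_{1,-1},p_{0,-1},p_{-1,-1},p_{-1,0},p_{-1,1},p_{0,1}$ there are no three consecutive zeros; (H3) $p_{1,1}+p_{-1,1}+p_{-1,-1}+p_{1,-1}<1$; and $$\textstyle\sum_{k,l}k\,p_{k,l}<0,\qquad \sum_{k,l}l\,p_{k,l}=0.$$ Then there exists a constant $D\in(0,\infty)$ such that for every fixed $j_0\ge1$, $$\mathbb{P}_{(i_0,j_0)}[(X,Y)\text{ hits }\mathcal{V}\text{ before }\mathcal{H}^*]\sim D\,\frac{j_0}{i_0^{1/2}},\qquad i_0\to\infty.$$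
   Context: $\mathcal{H}=\{(i,0):i\ge0\}$, $\mathcal{V}=\{(0,j):j\ge0\}$, $\mathcal{H}^*=\mathcal{H}\setminus\{(0,0)\}$; "hits $\mathcal{V}$ before $\mathcal{H}^*$" means the first point of $\mathcal{H}\cup\mathcal{V}$ visited lies in $\mathcal{V}$; $\mathbb{P}_{(i_0,j_0)}$ is the law started at $(i_0,j_0)$, $i_0,j_0\ge1$. *)

theory Defs
  imports "HOL-Probability.Probability" "HOL-Library.Landau_Symbols"
begin

text \<open>The walk in the interior of the quarter plane: an i.i.d. sequence of jumps
  \<omega> with law P (P (k,l) = p_{k,l}); the position after n steps is the start
  point plus the sum of the first n jumps. Until the first visit to the boundary
  H \<union> V, the Markov chain (X,Y) started at an interior point coincides in law
  with this walk, so only the walk is needed.\<close>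

definition walk_pos :: "int \<times> int \<Rightarrow> (int \<times> int) stream \<Rightarrow> nat \<Rightarrow> int \<times> int" where
  "walk_pos z \<omega> n = z + sum_list (stake n \<omega>)"

definition on_boundary :: "int \<times> int \<Rightarrow> bool" where
  "on_boundary z \<longleftrightarrow> (fst z \<ge> 0 \<and> snd z = 0) \<or> (fst z = 0 \<and> snd z \<ge> 0)"

definition hits_V_before_Hstar :: "int \<times> int \<Rightarrow> (int \<times> int) stream \<Rightarrow> bool" where
  "hits_V_before_Hstar z \<omega> \<longleftrightarrow>
     (\<exists>n. fst (walk_pos z \<omega> n) = 0 \<and> snd (walk_pos z \<omega> n) \<ge> 0
          \<and> (\<forall>m<n. \<not> on_boundary (walk_pos z \<omega> m)))"

definition hit_prob :: "(int \<times> int) pmf \<Rightarrow> int \<Rightarrow> int \<Rightarrow> real" where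
  "hit_prob P i0 j0 =
     measure (stream_space (measure_pmf P)) {\<omega>. hits_V_before_Hstar (i0, j0) \<omega>}"

end

theory Submission
  imports Defs "HOL-Real_Asymp.Real_Asymp"
begin

text \<open>X moves at speed \<open>-\<mu> < 0\<close>, so it reaches 0 at a time close to \<open>i0 / \<mu>\<close>, up to
  relative deviations of exponentially small probability. Hence the hitting probability is squeezed
  between the probabilities that Y, a symmetric lazy nearest-neighbour walk, stays positive up to
  time \<open>(1 \<plusminus> \<epsilon>) i0 / \<mu>\<close>. Those decay like \<open>c j0 / sqrt n\<close>: for the simple walk started at 1
  the probability is a central binomial coefficient (reflection) and Wallis' product applies; the
  lazy walk is a binomial time change of the simple one; and the one-step recursion transports the
  asymptotics from \<open>j0 = 1\<close> to all \<open>j0\<close>.\<close>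

subsection \<open>Survival of the simple walk\<close>

text \<open>\<open>surv q n j\<close> is the probability that the walk started at \<open>j\<close>, with steps 1 and -1 of
  probability \<open>q\<close> each and 0 otherwise, is positive at all times \<open>0, \<dots>, n\<close>.\<close>

primrec surv :: "real \<Rightarrow> nat \<Rightarrow> int \<Rightarrow> real" where
  "surv q 0 j = (if j > 0 then 1 else 0)"
| "surv q (Suc n) j = (if j > 0
     then q * surv q n (j + 1) + q * surv q n (j - 1) + (1 - 2 * q) * surv q n j else 0)"

lemma surv_eq_0: "j \<le> 0 \<Longrightarrow> surv q n j = 0"
  by (cases n) auto

lemma surv_nonneg: "0 \<le> q \<Longrightarrow> q \<le> 1 / 2 \<Longrightarrow> 0 \<le> surv q n j"
  by (induction n arbitrary: j) auto

lemma surv_Suc_le: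
  assumes "0 \<le> q" "q \<le> 1 / 2"
  shows "surv q (Suc n) j \<le> surv q n j"
proof (induction n arbitrary: j)
  case 0
  then show ?case using assms by auto
next
  case (Suc n)
  show ?case
    using Suc[of "j + 1"] Suc[of "j - 1"] Suc[of j] assms
    by (subst (1 2) surv.simps(2)) (auto simp del: surv.simps intro!: add_mono mult_left_mono)
qed

lemma surv_antimono: "0 \<le> q \<Longrightarrow> q \<le> 1 / 2 \<Longrightarrow> m \<le> n \<Longrightarrow> surv q n j \<le> surv q m j"
  by (metis decseqD decseq_SucI surv_Suc_le)

lemma surv_le_1: "0 \<le> q \<Longrightarrow> q \<le> 1 / 2 \<Longrightarrow> surv q n j \<le> 1"
  using surv_antimono[of q 0 n j] by (auto split: if_splits)

text \<open>\<open>2 ^ n\<close> times the distribution function of the number of heads in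
  \<open>n\<close> fair tosses. The threshold is an integer because reflection can make it negative,
  and the sum is then empty.\<close>

definition binomial_cdf :: "nat \<Rightarrow> int \<Rightarrow> real" where
  "binomial_cdf n t = (\<Sum>k | int k \<le> t. real (n choose k))"

lemma set_le_int: "{k. int k \<le> t} = (if t < 0 then {} else {..nat t})"
  by auto

text \<open>Pascal's rule summed up to the threshold; it plays the part of the one-step recursion of
  \<open>surv\<close> at \<open>q = 1 / 2\<close>.\<close>

lemma binomial_cdf_Suc: "binomial_cdf (Suc n) t = binomial_cdf n t + binomial_cdf n (t - 1)"
proof (cases "t \<le> 0")
  case True
  then show ?thesis by (cases "t = 0") (auto simp: binomial_cdf_def set_le_int)
next
  case False
  then obtain k where t: "t = int (Suc k)"
    by (metis gr0_implies_Suc not_le zero_less_imp_eq_int)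
  show ?thesis
    unfolding t binomial_cdf_def set_le_int
    by (simp add: sum.atMost_Suc_shift nat_add_distrib sum.distrib flip: sum.atMost_Suc)
qed

text \<open>The reflection principle; as a closed form it is verified by induction through Pascal's rule.\<close>

lemma surv_half:
  "j \<ge> 0 \<Longrightarrow> surv (1 / 2) n j * 2 ^ n
     = binomial_cdf n ((int n + j) div 2) - binomial_cdf n ((int n - j) div 2)"
proof (induction n arbitrary: j)
  case 0
  have "j > 0 \<Longrightarrow> - j div 2 < 0" by presburger
  moreover have "j > 0 \<Longrightarrow> (\<Sum>k\<le>nat (j div 2). real (0 choose k)) = 1"
    by (simp add: sum.atMost_shift)
  ultimately show ?case using 0 by (auto simp: binomial_cdf_def set_le_int)
next
  case (Suc n)
  \<comment> \<open>Lowering the threshold by 1 in Pascal's rule is the same as moving the start by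
    one site, whatever the parity of \<open>n + j\<close>. So the terms of
    \<open>binomial_cdf_Suc\<close> regroup into those of the neighbours \<open>j + 1\<close> and
    \<open>j - 1\<close>.\<close>
  have 1: "(1 + int n - j) div 2 - 1 = (int n - (j + 1)) div 2"
    "(1 + int n + j) div 2 - 1 = (int n + (j - 1)) div 2" by presburger+
  show ?case
  proof (cases "j = 0")
    case False
    then have "j > 0" using Suc by simp
    then have "surv (1 / 2) (Suc n) j * 2 ^ Suc n
       = surv (1 / 2) n (j + 1) * 2 ^ n + surv (1 / 2) n (j - 1) * 2 ^ n"
      by (simp add: algebra_simps)
    also have "\<dots> = binomial_cdf (Suc n) ((int (Suc n) + j) div 2)
        - binomial_cdf (Suc n) ((int (Suc n) - j) div 2)"
      using Suc.IH[of "j + 1"] Suc.IH[of "j - 1"] \<open>j > 0\<close> 1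
      by (simp add: binomial_cdf_Suc algebra_simps)
    finally show ?thesis .
  qed auto
qed

section \<open>Start at 1: central binomial coefficients and Wallis' product\<close>

lemma binomial_cdf_diff: "binomial_cdf n (int k) - binomial_cdf n (int k - 1) = n choose k"
  by (cases k) (auto simp: binomial_cdf_def set_le_int nat_add_distrib atMost_def[symmetric])

text \<open>For start 1 the two reflected thresholds differ by exactly 1, so a single coefficient
  survives in the difference; it is a central one for both parities of \<open>n\<close>.\<close>

lemma surv_half_1: "surv (1 / 2) n 1 = real (n choose ((n + 1) div 2)) / 2 ^ n"
proof -
  have "(int n + 1) div 2 = int ((n + 1) div 2)" "(int n - 1) div 2 = int ((n + 1) div 2) - 1"
    by presburger+
  then have "surv (1 / 2) n 1 * 2 ^ n = real (n choose ((n + 1) div 2))"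
    using surv_half[of 1 n] binomial_cdf_diff[of n "(n + 1) div 2"] by (simp only:)
  then show ?thesis by (simp add: eq_divide_eq)
qed

text \<open>After an odd number of steps from 1 the position is even, so a surviving walk is at 2 or
  higher and cannot die in the next step. This reduces odd times to even ones.\<close>

lemma surv_half_1_odd: "surv (1 / 2) (2 * m + 1) 1 = surv (1 / 2) (2 * m + 2) 1"
  using binomial_symmetric[of m "Suc (2 * m)"]
  by (simp add: surv_half_1 add_divide_distrib del: surv.simps)

text \<open>The ratio of consecutive central binomial coefficients, obtained by applying the
  absorption identity twice in the natural numbers.\<close>

lemma surv_half_1_even: "surv (1 / 2) (2 * Suc m) 1 = surv (1 / 2) (2 * m) 1 * ((2 * m + 1) / (2 * m + 2))"
proof -
  have "Suc m * (Suc (Suc (2 * m)) choose Suc m) = 2 * Suc m * (2 * m + 1 choose m)"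
    using Suc_times_binomial_eq[of "2 * m + 1" m] by (simp add: algebra_simps)
  moreover have "Suc m * (2 * m + 1 choose m) = Suc (2*m) * (2 * m choose m)"
    using Suc_times_binomial_eq[of "2 * m" m] binomial_symmetric[of m "Suc (2 * m)"]
    by (simp del: binomial_Suc_Suc add: mult_ac)
  ultimately have "Suc m * (Suc (Suc (2 * m)) choose Suc m) = 2 * (Suc (2*m) * (2 * m choose m))"
    by (metis mult.assoc mult.commute)
  then have "real (Suc m) * real (Suc (Suc (2 * m)) choose Suc m) = 2 * (real (Suc (2*m)) * real (2 * m choose m))"
    by (metis of_nat_mult of_nat_numeral)
  then have "real (Suc (Suc (2 * m)) choose Suc m) = 2 * ((2 * m + 1) * real (2 * m choose m)) / (m + 1)"
    by (simp add: eq_divide_eq mult_ac add_ac del: binomial_Suc_Suc)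
  then show ?thesis
    unfolding surv_half_1 by (simp add: divide_simps del: binomial_Suc_Suc) (simp add: algebra_simps)
qed

text \<open>The factor \<open>2 * n + 1\<close> makes the identity exact: in one step the left side
  gains \<open>(2 * n + 1) * (2 * n + 3) / (2 * n + 2)\<^sup>2\<close>, the inverse of the Wallis
  factor at \<open>k = n + 1\<close>.\<close>

lemma surv_half_1_wallis:
  "(surv (1 / 2) (2 * n) 1)\<^sup>2 * (2 * n + 1) = inverse (\<Prod>k=1..n. (4*real k^2) / (4*real k^2 - 1))"
proof (induction n)
  case (Suc n)
  have "(surv (1 / 2) (2 * Suc n) 1)\<^sup>2 * (2 * Suc n + 1)
     = ((surv (1 / 2) (2 * n) 1)\<^sup>2 * (2 * n + 1)) * ((2 * n + 1) * (2 * n + 3) / (2 * n + 2)\<^sup>2)"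
    unfolding surv_half_1_even
    by (simp add: power_mult_distrib power_divide mult_ac) (simp add: power2_eq_square algebra_simps)
  also have "(2 * n + 1) * (2 * n + 3) / (2 * n + 2)\<^sup>2 =
     inverse ((4*real (Suc n)^2) / (4*real (Suc n)^2 - 1))"
    by (simp add: power2_eq_square algebra_simps)
  finally have "(surv (1 / 2) (2 * Suc n) 1)\<^sup>2 * (2 * Suc n + 1) =
    inverse (\<Prod>k=1..n. (4*real k^2) / (4*real k^2 - 1)) * inverse ((4*real (Suc n)^2) / (4*real (Suc n)^2 - 1))"
    unfolding Suc.IH .
  also have "\<dots> = inverse (\<Prod>k=1..Suc n. (4*real k^2) / (4*real k^2 - 1))"
    by (subst prod.cl_ivl_Suc, subst if_not_P, simp, subst inverse_mult_distrib, rule refl)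
  finally show ?case .
qed auto

lemma surv_half_limit: "(\<lambda>n. surv (1 / 2) n 1 * sqrt n) \<longlonglongrightarrow> sqrt (2 / pi)"
proof -
  define w where "w n = (surv (1 / 2) (2 * n) 1)\<^sup>2 * (2 * n + 1)" for n
  have w: "w \<longlonglongrightarrow> 2 / pi"
    using tendsto_inverse[OF wallis] unfolding w_def surv_half_1_wallis by simp
  \<comment> \<open>The quotient exchanges the weight \<open>2 * n + 1\<close> inside
    \<open>w\<close> for the weight wanted at time \<open>2 * n\<close>.\<close>
  have *: "(\<lambda>n. sqrt (w n * (2 * n / (2 * n + 1)))) \<longlonglongrightarrow> sqrt (2 / pi * 1)"
    by (intro tendsto_intros w) real_asymp
  \<comment> \<open>Time \<open>2 * n + 1\<close> has the same survival probability as time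
    \<open>2 * n + 2\<close>, hence the shift to \<open>w (Suc n)\<close>, whose weight is
    \<open>2 * n + 3\<close>.\<close>
  have **: "(\<lambda>n. sqrt (w (Suc n) * ((2 * n + 1) / (2 * n + 3)))) \<longlonglongrightarrow> sqrt (2 / pi * 1)"
    by (intro tendsto_intros w[THEN LIMSEQ_Suc]) real_asymp
  show ?thesis
  proof (rule limseq_even_odd)
    have "surv (1 / 2) (2 * n) 1 * sqrt (2 * n) = sqrt (w n * (2 * n / (2 * n + 1)))" for n
      by (simp add: w_def add_ac) (simp add: mult.assoc real_sqrt_mult surv_nonneg)
    then show "(\<lambda>n. surv (1 / 2) (2 * n) 1 * sqrt (real (2 * n))) \<longlonglongrightarrow> sqrt (2 / pi)"
      using * by (simp add: add_ac)
    have "surv (1 / 2) (2 * n + 1) 1 * sqrt (2 * n + 1) = sqrt (w (Suc n) * ((2 * n + 1) / (2 * n + 3)))" for n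
      unfolding surv_half_1_odd
      by (simp add: w_def add_ac del: surv.simps)
         (simp add: mult.assoc real_sqrt_mult surv_nonneg del: surv.simps)
    then show "(\<lambda>n. surv (1 / 2) (2 * n + 1) 1 * sqrt (real (2 * n + 1))) \<longlonglongrightarrow> sqrt (2 / pi)"
      using ** by (simp add: add_ac del: surv.simps)
  qed
qed

subsection \<open>Survival of the lazy walk\<close>

text \<open>Meant for a \<open>g\<close> that averages a decreasing \<open>f\<close> over a random
  time concentrated near \<open>a * i\<close>. It serves twice: for the number of moving steps of
  the lazy walk (\<open>a = 2 * q\<close>) and for the time at which X reaches 0
  (\<open>a = 1 / \<mu>\<close>).\<close>

lemma sqrt_squeeze:
  fixes f g :: "nat \<Rightarrow> real" and L a :: real
  assumes f: "(\<lambda>n. f n * sqrt n) \<longlonglongrightarrow> L" and a: "a > 0"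
    and up: "\<And>\<epsilon>. 0 < \<epsilon> \<Longrightarrow> \<epsilon> < 1 \<Longrightarrow>
      \<exists>C c::real. c > 0 \<and> (\<forall>\<^sub>F i in sequentially. g i \<le> f (nat \<lfloor>(1 - \<epsilon>) * a * i\<rfloor>) + C * exp (- c * i))"
    and lo: "\<And>\<epsilon>. 0 < \<epsilon> \<Longrightarrow> \<epsilon> < 1 \<Longrightarrow>
      \<exists>C c::real. c > 0 \<and> (\<forall>\<^sub>F i in sequentially. f (nat \<lfloor>(1 + \<epsilon>) * a * i\<rfloor>) - C * exp (- c * i) \<le> g i)"
  shows "(\<lambda>i. g i * sqrt i) \<longlonglongrightarrow> L / sqrt a"
proof -
  have err: "(\<lambda>i. C * exp (- c * real i) * sqrt i) \<longlonglongrightarrow> 0" if "c > 0" for C c :: real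
    using that by real_asymp
  have scaled: "(\<lambda>i. f (nat \<lfloor>b * real i\<rfloor>) * sqrt i) \<longlonglongrightarrow> L / sqrt b" if "b > 0" for b
  proof -
    have N: "filterlim (\<lambda>i. nat \<lfloor>b * real i\<rfloor>) at_top sequentially"
      using that by real_asymp
    have "(\<lambda>i. sqrt (real i / real (nat \<lfloor>b * real i\<rfloor>))) \<longlonglongrightarrow> sqrt (inverse b)"
    proof (rule tendsto_real_sqrt)
      show "(\<lambda>i. real i / real (nat \<lfloor>b * real i\<rfloor>)) \<longlonglongrightarrow> inverse b"
        using that by real_asymp
    qed
    from tendsto_mult[OF filterlim_compose[OF f N] this]
    have "(\<lambda>i. f (nat \<lfloor>b * real i\<rfloor>) * sqrt (nat \<lfloor>b * real i\<rfloor>) * sqrt (real i / real (nat \<lfloor>b * real i\<rfloor>)))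
      \<longlonglongrightarrow> L * sqrt (inverse b)" .
    moreover have "\<forall>\<^sub>F i in sequentially. f (nat \<lfloor>b * real i\<rfloor>) * sqrt (nat \<lfloor>b * real i\<rfloor>) * sqrt (real i / real (nat \<lfloor>b * real i\<rfloor>))
       = f (nat \<lfloor>b * real i\<rfloor>) * sqrt i"
      using eventually_compose_filterlim[OF eventually_gt_at_top[of 0] N]
    proof eventually_elim
      case (elim i)
      have *: "x * sqrt (real N) * (t / sqrt (real N)) = x * t" if "N > 0" for x t and N :: nat
        using that by simp
      show ?case unfolding real_sqrt_divide by (rule *[OF elim])
    qed
    ultimately have "(\<lambda>i. f (nat \<lfloor>b * real i\<rfloor>) * sqrt i) \<longlonglongrightarrow> L * sqrt (inverse b)"
      by (rule Lim_transform_eventually)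
    then show ?thesis by (simp add: real_sqrt_inverse divide_inverse)
  qed
  show ?thesis
  proof (rule order_tendstoI)
    fix y assume y: "L / sqrt a < y"
    \<comment> \<open>By continuity at 0, some fixed \<open>\<epsilon>\<close> keeps the limit of
      the upper bound below \<open>y\<close>; only then does \<open>i\<close> tend to
      infinity.\<close>
    have "((\<lambda>\<epsilon>. L / sqrt ((1 - \<epsilon>) * a)) \<longlongrightarrow> L / sqrt ((1 - 0) * a)) (at_right 0)"
      by (intro tendsto_intros) (use a in auto)
    with y have "\<forall>\<^sub>F \<epsilon> in at_right 0. L / sqrt ((1 - \<epsilon>) * a) < y"
      by (intro order_tendstoD) auto
    moreover have "\<forall>\<^sub>F \<epsilon> in at_right (0::real). 0 < \<epsilon> \<and> \<epsilon> < 1"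
      using eventually_at_right_real[of 0 1] by simp
    ultimately have "\<forall>\<^sub>F \<epsilon> in at_right 0. L / sqrt ((1 - \<epsilon>) * a) < y \<and> 0 < \<epsilon> \<and> \<epsilon> < 1"
      by (rule eventually_conj)
    then obtain \<epsilon> where \<epsilon>: "L / sqrt ((1 - \<epsilon>) * a) < y" "0 < \<epsilon>" "\<epsilon> < 1"
      using eventually_happens' trivial_limit_at_right_real by blast
    from up[OF \<epsilon>(2,3)] obtain C c :: real where c: "c > 0" and
      *: "\<forall>\<^sub>F i in sequentially. g i \<le> f (nat \<lfloor>(1 - \<epsilon>) * a * i\<rfloor>) + C * exp (- c * i)"
      by blast
    have "(\<lambda>i. f (nat \<lfloor>(1 - \<epsilon>) * a * real i\<rfloor>) * sqrt i + C * exp (- c * real i) * sqrt i)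
       \<longlonglongrightarrow> L / sqrt ((1 - \<epsilon>) * a) + 0"
      by (intro tendsto_add scaled err c mult_pos_pos a) (use \<epsilon> in auto)
    then have "\<forall>\<^sub>F i in sequentially. f (nat \<lfloor>(1 - \<epsilon>) * a * real i\<rfloor>) * sqrt i + C * exp (- c * real i) * sqrt i < y"
      using \<epsilon> by (intro order_tendstoD) auto
    with * show "\<forall>\<^sub>F i in sequentially. g i * sqrt i < y"
    proof eventually_elim
      case (elim i)
      have "g i * sqrt i \<le> (f (nat \<lfloor>(1 - \<epsilon>) * a * i\<rfloor>) + C * exp (- c * i)) * sqrt i"
        using elim by (intro mult_right_mono) auto
      then show ?case using elim by (simp add: distrib_right)
    qed
  next
    fix y assume y: "y < L / sqrt a"
    have "((\<lambda>\<epsilon>. L / sqrt ((1 + \<epsilon>) * a)) \<longlongrightarrow> L / sqrt ((1 + 0) * a)) (at_right 0)"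
      by (intro tendsto_intros) (use a in auto)
    with y have "\<forall>\<^sub>F \<epsilon> in at_right 0. y < L / sqrt ((1 + \<epsilon>) * a)"
      by (intro order_tendstoD) auto
    moreover have "\<forall>\<^sub>F \<epsilon> in at_right (0::real). 0 < \<epsilon> \<and> \<epsilon> < 1"
      using eventually_at_right_real[of 0 1] by simp
    ultimately have "\<forall>\<^sub>F \<epsilon> in at_right 0. y < L / sqrt ((1 + \<epsilon>) * a) \<and> 0 < \<epsilon> \<and> \<epsilon> < 1"
      by (rule eventually_conj)
    then obtain \<epsilon> where \<epsilon>: "y < L / sqrt ((1 + \<epsilon>) * a)" "0 < \<epsilon>" "\<epsilon> < 1"
      using eventually_happens' trivial_limit_at_right_real by blast
    from lo[OF \<epsilon>(2,3)] obtain C c :: real where c: "c > 0" and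
      *: "\<forall>\<^sub>F i in sequentially. f (nat \<lfloor>(1 + \<epsilon>) * a * i\<rfloor>) - C * exp (- c * i) \<le> g i"
      by blast
    have "(\<lambda>i. f (nat \<lfloor>(1 + \<epsilon>) * a * real i\<rfloor>) * sqrt i - C * exp (- c * real i) * sqrt i)
       \<longlonglongrightarrow> L / sqrt ((1 + \<epsilon>) * a) - 0"
      by (intro tendsto_diff scaled err c mult_pos_pos a) (use \<epsilon> in auto)
    then have "\<forall>\<^sub>F i in sequentially. y < f (nat \<lfloor>(1 + \<epsilon>) * a * real i\<rfloor>) * sqrt i - C * exp (- c * real i) * sqrt i"
      using \<epsilon> by (intro order_tendstoD) auto
    with * show "\<forall>\<^sub>F i in sequentially. y < g i * sqrt i"
    proof eventually_elim
      case (elim i)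
      have "(f (nat \<lfloor>(1 + \<epsilon>) * a * i\<rfloor>) - C * exp (- c * i)) * sqrt i \<le> g i * sqrt i"
        using elim by (intro mult_right_mono) auto
      then show ?case using elim by (simp add: left_diff_distrib)
    qed
  qed
qed

text \<open>Conditioning on one trial; a success stands for a step of the lazy walk that
  moves.\<close>

lemma expectation_binomial_pmf_Suc:
  fixes f :: "nat \<Rightarrow> real"
  assumes "p \<in> {0..1}"
  shows "measure_pmf.expectation (binomial_pmf (Suc n) p) f
    = p * measure_pmf.expectation (binomial_pmf n p) (\<lambda>k. f (Suc k))
      + (1 - p) * measure_pmf.expectation (binomial_pmf n p) f"
proof -
  have "binomial_pmf (Suc n) p
    = bind_pmf (bernoulli_pmf p) (\<lambda>b. map_pmf (\<lambda>k. (if b then 1 else 0) + k) (binomial_pmf n p))"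
    by (subst binomial_pmf_Suc[OF assms]) (simp add: map_pmf_def)
  moreover have "finite (set_pmf (binomial_pmf n p))"
    using assms by (rule finite_set_pmf_binomial_pmf)
  ultimately show ?thesis using assms
    by (subst \<open>binomial_pmf (Suc n) p = _\<close>, subst pmf_expectation_bind[where A = UNIV])
       (auto simp: UNIV_bool)
qed

text \<open>Only the steps that move the walk matter for survival, and their number is binomial.\<close>

lemma surv_mixture:
  assumes "0 \<le> q" "q \<le> 1 / 2"
  shows "surv q n j = measure_pmf.expectation (binomial_pmf n (2 * q)) (\<lambda>k. surv (1 / 2) k j)"
proof (induction n arbitrary: j)
  case 0
  then show ?case using assms by (simp add: binomial_pmf_0)
next
  case (Suc n)
  have q: "2 * q \<in> {0..1}" using assms by auto
  show ?case
  proof (cases "j > 0")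
    case True
    \<comment> \<open>The case of a success: given that it moves, the walk goes up or down with
      probability 1/2 each, and the induction hypothesis covers the remaining \<open>n\<close>
      steps.\<close>
    have "measure_pmf.expectation (binomial_pmf n (2 * q)) (\<lambda>k. surv (1 / 2) (Suc k) j)
      = (surv q n (j + 1) + surv q n (j - 1)) / 2"
      using True q by (simp add: Suc add_divide_distrib)
    then have "measure_pmf.expectation (binomial_pmf (Suc n) (2 * q)) (\<lambda>k. surv (1 / 2) k j)
      = 2 * q * ((surv q n (j + 1) + surv q n (j - 1)) / 2) + (1 - 2 * q) * surv q n j"
      by (simp only: expectation_binomial_pmf_Suc[OF q] Suc)
    then show ?thesis
      using True by (simp add: algebra_simps)
  qed (simp add: surv_eq_0)
qed

text \<open>The number of moving steps is within a factor \<open>1 \<plusminus> \<epsilon>\<close>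
  of its mean \<open>2 * q * n\<close> up to an exponentially small probability, by Hoeffding's
  inequality. Survival decreases in time, so \<open>sqrt_squeeze\<close> applies.\<close>

lemma surv_limit_1:
  assumes q: "0 < q" "q \<le> 1 / 2"
  shows "(\<lambda>n. surv q n 1 * sqrt n) \<longlonglongrightarrow> sqrt (2 / pi) / sqrt (2 * q)"
proof (rule sqrt_squeeze[where f = "\<lambda>n. surv (1 / 2) n 1" and g = "\<lambda>n. surv q n 1", OF surv_half_limit])
  let ?v = "\<lambda>n. surv (1 / 2) n 1"
  fix \<epsilon> :: real assume \<epsilon>: "0 < \<epsilon>" "\<epsilon> < 1"
  \<comment> \<open>The rate in Hoeffding's bound for a deviation of
    \<open>\<epsilon> * (2 * q) * n\<close>; see \<open>c'\<close>.\<close>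
  define c where "c = 2 * (\<epsilon> * (2 * q))\<^sup>2"
  have c: "c > 0" using \<epsilon> q by (simp add: c_def)
  have q01: "2 * q \<in> {0..1}" using q by auto
  have c': "- 2 * (\<epsilon> * (2 * q) * real n)\<^sup>2 / real n = - c * n" for n
    by (cases "n = 0") (auto simp: c_def power2_eq_square)
  have up: "surv q n 1 \<le> ?v (nat \<lfloor>(1 - \<epsilon>) * (2 * q) * n\<rfloor>) + exp (- c * n)" if "n > 0" for n :: nat
  proof -
    let ?N = "nat \<lfloor>(1 - \<epsilon>) * (2 * q) * n\<rfloor>"
    interpret B: binomial_distribution n "2 * q" by unfold_locales (rule q01)
    let ?A = "{k. real k \<le> n * (2 * q) - \<epsilon> * (2 * q) * n}"
    have "?v k \<le> ?v ?N + indicator ?A k" for k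
    proof (cases "k \<ge> ?N")
      case True
      then show ?thesis using surv_antimono[of "1 / 2" ?N k 1] by (auto simp: indicator_def)
    next
      case False
      then have "real k \<le> (1 - \<epsilon>) * (2 * q) * n" by linarith
      then show ?thesis using surv_le_1[of "1 / 2" k 1] surv_nonneg[of "1 / 2" ?N 1]
        by (auto simp: indicator_def algebra_simps)
    qed
    then have "surv q n 1 \<le> measure_pmf.expectation (binomial_pmf n (2 * q)) (\<lambda>k. ?v ?N + indicator ?A k)"
      unfolding surv_mixture[OF less_imp_le[OF q(1)] q(2)] using q01
      by (intro integral_mono) auto
    also have "\<dots> = ?v ?N + measure_pmf.prob (binomial_pmf n (2 * q)) ?A"
      using q01 by simp
    also have "\<dots> \<le> ?v ?N + exp (- c * n)"
      using B.prob_le[OF that, of "\<epsilon> * (2 * q) * n"] q \<epsilon> unfolding c' by simp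
    finally show ?thesis .
  qed
  have lo: "?v (nat \<lfloor>(1 + \<epsilon>) * (2 * q) * n\<rfloor>) - exp (- c * n) \<le> surv q n 1" if "n > 0" for n :: nat
  proof -
    let ?N = "nat \<lfloor>(1 + \<epsilon>) * (2 * q) * n\<rfloor>"
    interpret B: binomial_distribution n "2 * q" by unfold_locales (rule q01)
    let ?A = "{k. real k \<ge> n * (2 * q) + \<epsilon> * (2 * q) * n}"
    have "?v ?N - indicator ?A k \<le> ?v k" for k
    proof (cases "k \<le> ?N")
      case True
      then show ?thesis using surv_antimono[of "1 / 2" k ?N 1] by (auto simp: indicator_def)
    next
      case False
      then have "real k \<ge> (1 + \<epsilon>) * (2 * q) * n" by linarith
      then show ?thesis using surv_le_1[of "1 / 2" ?N 1] surv_nonneg[of "1 / 2" k 1]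
        by (auto simp: indicator_def algebra_simps)
    qed
    then have "measure_pmf.expectation (binomial_pmf n (2 * q)) (\<lambda>k. ?v ?N - indicator ?A k) \<le> surv q n 1"
      unfolding surv_mixture[OF less_imp_le[OF q(1)] q(2)] using q01
      by (intro integral_mono) auto
    moreover have "measure_pmf.expectation (binomial_pmf n (2 * q)) (\<lambda>k. ?v ?N - indicator ?A k)
        = ?v ?N - measure_pmf.prob (binomial_pmf n (2 * q)) ?A"
      using q01 by simp
    ultimately show ?thesis
      using B.prob_ge[OF that, of "\<epsilon> * (2 * q) * n"] q \<epsilon> unfolding c' by simp
  qed
  show "\<exists>C c::real. c > 0 \<and> (\<forall>\<^sub>F n in sequentially. surv q n 1 \<le> ?v (nat \<lfloor>(1 - \<epsilon>) * (2 * q) * n\<rfloor>) + C * exp (- c * n))"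
    using c up by (intro exI[of _ 1] exI[of _ c] conjI eventually_mono[OF eventually_gt_at_top[of 0]]) auto
  show "\<exists>C c::real. c > 0 \<and> (\<forall>\<^sub>F n in sequentially. ?v (nat \<lfloor>(1 + \<epsilon>) * (2 * q) * n\<rfloor>) - C * exp (- c * n) \<le> surv q n 1)"
    using c lo by (intro exI[of _ 1] exI[of _ c] conjI eventually_mono[OF eventually_gt_at_top[of 0]]) auto
qed (use q in auto)

text \<open>The one-step recursion at \<open>k + 1\<close> is solved for the value at
  \<open>k + 2\<close>. As \<open>sqrt n\<close> and \<open>sqrt (Suc n)\<close> are equivalent, the
  limits \<open>h\<close> satisfy \<open>h (k + 2) = 2 * h (k + 1) - h k\<close>; with
  \<open>h 0 = 0\<close> they are linear in the start.\<close>

lemma surv_limit: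
  assumes q: "0 < q" "q \<le> 1 / 2"
  shows "(\<lambda>n. surv q n (int j) * sqrt n) \<longlonglongrightarrow> j * (sqrt (2 / pi) / sqrt (2 * q))"
proof (induction j rule: less_induct)
  case (less j)
  let ?c = "sqrt (2 / pi) / sqrt (2 * q)"
  consider "j = 0" | "j = 1" | k where "j = Suc (Suc k)"
    by (metis One_nat_def not0_implies_Suc)
  then show ?case
  proof cases
    case 1
    then show ?thesis by (simp add: surv_eq_0)
  next
    case 2
    then show ?thesis using surv_limit_1[OF q] by simp
  next
    case 3
    have k: "(\<lambda>n. surv q n (int k) * sqrt n) \<longlonglongrightarrow> k * ?c"
      and Sk: "(\<lambda>n. surv q n (int (Suc k)) * sqrt n) \<longlonglongrightarrow> Suc k * ?c"
      using less[of k] less[of "Suc k"] 3 by (simp_all del: of_nat_Suc)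
    have "(\<lambda>n. sqrt n / sqrt (Suc n)) \<longlonglongrightarrow> 1" by real_asymp
    from tendsto_mult[OF LIMSEQ_Suc[OF Sk] this]
    have S: "(\<lambda>n. surv q (Suc n) (int (Suc k)) * sqrt n) \<longlonglongrightarrow> Suc k * ?c"
      by (simp del: surv.simps of_nat_Suc)
    have eq: "surv q n (int j) = (surv q (Suc n) (int (Suc k)) - (1 - 2 * q) * surv q n (int (Suc k))) / q
        - surv q n (int k)" for n
      using q by (simp add: 3 field_simps)
    have "(\<lambda>n. (surv q (Suc n) (int (Suc k)) * sqrt n - (1 - 2 * q) * (surv q n (int (Suc k)) * sqrt n)) / q
        - surv q n (int k) * sqrt n) \<longlonglongrightarrow> (Suc k * ?c - (1 - 2 * q) * (Suc k * ?c)) / q - k * ?c"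
      by (intro tendsto_intros S Sk k) (use q in auto)
    moreover have "(Suc k * c - (1 - 2 * q) * (Suc k * c)) / q - k * c = j * c" for c :: real
      using q by (simp add: 3 field_simps)
    moreover have "((A - d * B) / q - K) * s = (A * s - d * (B * s)) / q - K * s" for A B d K s :: real
      using q by (simp add: field_simps)
    ultimately show ?thesis
      unfolding eq by (simp only:)
  qed
qed

subsection \<open>First-step analysis of the planar walk\<close>

lemma walk_pos_0 [simp]: "walk_pos z \<omega> 0 = z"
  by (simp add: walk_pos_def)

lemma walk_pos_Suc: "walk_pos z \<omega> (Suc n) = walk_pos z \<omega> n + \<omega> !! n"
  by (simp add: walk_pos_def stake_Suc add.assoc del: stake.simps)

lemma walk_pos_Stream: "walk_pos z (x ## \<omega>) (Suc n) = walk_pos (z + x) \<omega> n"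
  by (simp add: walk_pos_def add.assoc)

text \<open>The position is a function of the first \<open>n\<close> jumps, and lists of jumps carry
  the discrete sigma-algebra, so \<open>R\<close> can be arbitrary.\<close>

lemma pred_walk_pos [measurable]: "Measurable.pred (stream_space (measure_pmf P)) (\<lambda>\<omega>. R (walk_pos z \<omega> n))"
proof -
  have "sets (stream_space (measure_pmf P)) = sets (stream_space (count_space UNIV))"
    by (intro sets_stream_space_cong) simp
  then have "stake n \<in> stream_space (measure_pmf P) \<rightarrow>\<^sub>M count_space UNIV"
    using measurable_stake measurable_cong_sets by blast
  then show ?thesis unfolding walk_pos_def
    by (rule measurable_compose[where g = "\<lambda>xs. R (z + sum_list xs)"]) simp
qed

lemma pred_hits_V [measurable]: "Measurable.pred (stream_space (measure_pmf P)) (hits_V_before_Hstar z)"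
proof -
  have 1: "Measurable.pred (stream_space (measure_pmf P))
      (\<lambda>\<omega>. fst (walk_pos z \<omega> n) = 0 \<and> snd (walk_pos z \<omega> n) \<ge> 0)" for n
    by (rule pred_walk_pos[where R = "\<lambda>x. fst x = 0 \<and> snd x \<ge> 0"])
  have 2: "Measurable.pred (stream_space (measure_pmf P)) (\<lambda>\<omega>. \<forall>m\<in>{..<n}. \<not> on_boundary (walk_pos z \<omega> m))" for n
    by (intro pred_intros_countable_bounded(3) pred_walk_pos[where R = "\<lambda>x. \<not> on_boundary x"])
  have "hits_V_before_Hstar z = (\<lambda>\<omega>. \<exists>n. (fst (walk_pos z \<omega> n) = 0 \<and> snd (walk_pos z \<omega> n) \<ge> 0)
      \<and> (\<forall>m\<in>{..<n}. \<not> on_boundary (walk_pos z \<omega> m)))"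
    by (auto simp: hits_V_before_Hstar_def fun_eq_iff)
  then show ?thesis
    using pred_intros_countable(2)[OF pred_intros_logic(3)[OF 1 2]] by simp
qed

lemma space_stream_space_pmf [simp]: "space (stream_space (measure_pmf P)) = UNIV"
  by (simp add: space_stream_space)

lemma prob_space_stream_pmf: "prob_space (stream_space (measure_pmf P))"
  by (rule prob_space.prob_space_stream_space[OF measure_pmf.prob_space_axioms])

text \<open>The Markov property at time 1, on which the inductions below rest. Finite support gives
  integrability, so the nonnegative integral turns into a real expectation.\<close>

lemma measure_first_step:
  assumes "finite (set_pmf P)" and [measurable]: "Measurable.pred (stream_space (measure_pmf P)) Q"
  shows "measure (stream_space (measure_pmf P)) {\<omega>. Q \<omega>}
    = measure_pmf.expectation P (\<lambda>x. measure (stream_space (measure_pmf P)) {\<omega>. Q (x ## \<omega>)})"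
proof -
  have "{\<omega>. Q \<omega>} \<in> sets (stream_space (measure_pmf P))"
    using assms(2) by (simp add: pred_def)
  then have "ennreal (measure (stream_space (measure_pmf P)) {\<omega>. Q \<omega>})
    = (\<integral>\<^sup>+x. measure (stream_space (measure_pmf P)) {\<omega>. Q (x ## \<omega>)} \<partial>measure_pmf P)"
    using prob_space.prob_stream_space[OF measure_pmf.prob_space_axioms, of P Q] by simp
  also have "\<dots> = ennreal (measure_pmf.expectation P (\<lambda>x. measure (stream_space (measure_pmf P)) {\<omega>. Q (x ## \<omega>)}))"
    by (rule nn_integral_eq_integral) (auto intro: integrable_measure_pmf_finite assms(1))
  finally show ?thesis
    by (subst (asm) ennreal_inj) auto
qed

lemma all_le_Suc_shift: "(\<forall>m\<le>Suc n. Q m) \<longleftrightarrow> Q 0 \<and> (\<forall>m\<le>n. Q (Suc m))"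
  by (metis Suc_le_mono le0 not0_implies_Suc)

lemma ex_le_Suc_shift: "(\<exists>m\<le>Suc n. Q m) \<longleftrightarrow> Q 0 \<or> (\<exists>m\<le>n. Q (Suc m))"
  by (metis Suc_le_mono le0 not0_implies_Suc)

lemma expectation_unit_step:
  fixes R :: "int pmf" and f :: "int \<Rightarrow> real"
  assumes "set_pmf R \<subseteq> {-1..1}"
  shows "measure_pmf.expectation R f = f (-1) * pmf R (-1) + f 0 * pmf R 0 + f 1 * pmf R 1"
proof -
  have "{-1..1} = {-1, 0, 1::int}" by auto
  with assms have "measure_pmf.expectation R f = (\<Sum>a\<in>{-1, 0, 1}. f a * pmf R a)"
    by (intro integral_measure_pmf_real) auto
  then show ?thesis by simp
qed

text \<open>The event involves only the second coordinate, a lazy walk by itself however the two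
  coordinates are correlated; its first-step equation is the recursion of
  \<open>surv\<close>.\<close>

lemma prob_second_coordinate_positive:
  assumes P: "finite (set_pmf P)"
    and R: "set_pmf (map_pmf snd P) \<subseteq> {-1..1}"
    and q: "pmf (map_pmf snd P) 1 = q" "pmf (map_pmf snd P) (-1) = q"
  shows "measure (stream_space (measure_pmf P)) {\<omega>. \<forall>m\<le>n. 0 < snd (walk_pos z \<omega> m)} = surv q n (snd z)"
proof (induction n arbitrary: z)
  case 0
  then show ?case using prob_space.prob_space[OF prob_space_stream_pmf[of P]] by simp
next
  case (Suc n)
  have "pmf (map_pmf snd P) 0 = 1 - 2 * q"
    using expectation_unit_step[OF R, of "\<lambda>_. 1"] q by simp
  then have step: "measure_pmf.expectation P (\<lambda>x. f (snd x)) = f (-1) * q + f 0 * (1 - 2 * q) + f 1 * q"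
    for f :: "int \<Rightarrow> real"
    using expectation_unit_step[OF R, of f] q by simp
  have "measure (stream_space (measure_pmf P)) {\<omega>. \<forall>m\<le>Suc n. 0 < snd (walk_pos z \<omega> m)}
    = measure_pmf.expectation P (\<lambda>x. if 0 < snd z then surv q n (snd z + snd x) else 0)"
    by (subst measure_first_step[OF P], measurable, cases "0 < snd z")
       (simp_all add: all_le_Suc_shift walk_pos_Stream Suc)
  also have "\<dots> = surv q (Suc n) (snd z)"
    using step[of "\<lambda>y. surv q n (snd z + y)"] by (simp add: algebra_simps)
  finally show ?case .
qed

text \<open>A Chernoff bound for the running minimum: the mean of
  \<open>exp (- \<theta> * X)\<close> grows at most by the factor \<open>r\<close> per step. With
  \<open>1 \<le> r\<close> the bound stays at least 1 for nonpositive starts, where the event is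
  certain.\<close>

lemma prob_first_coordinate_nonpos_le:
  fixes P :: "(int \<times> int) pmf" and \<theta> :: real
  assumes P: "finite (set_pmf P)" and \<theta>: "0 \<le> \<theta>" and r: "1 \<le> r"
    and r': "measure_pmf.expectation P (\<lambda>x. exp (- \<theta> * real_of_int (fst x))) \<le> r"
  shows "measure (stream_space (measure_pmf P)) {\<omega>. \<exists>m\<le>n. fst (walk_pos z \<omega> m) \<le> 0} \<le> exp (- \<theta> * real_of_int (fst z)) * r ^ n"
proof (induction n arbitrary: z)
  case 0
  then show ?case using \<theta> prob_space.prob_space[OF prob_space_stream_pmf[of P]]
    by (simp add: mult_nonneg_nonpos)
next
  case (Suc n)
  show ?case
  proof (cases "fst z \<le> 0")
    case True
    have "1 \<le> exp (- \<theta> * real_of_int (fst z))" using True \<theta> by (simp add: mult_nonneg_nonpos)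
    then have "1 * 1 \<le> exp (- \<theta> * real_of_int (fst z)) * r ^ Suc n"
      using r by (intro mult_mono) (auto intro: one_le_power simp del: power_Suc)
    then show ?thesis
      using prob_space.prob_le_1[OF prob_space_stream_pmf[of P]] order_trans by fastforce
  next
    case False
    have "measure (stream_space (measure_pmf P)) {\<omega>. \<exists>m\<le>Suc n. fst (walk_pos z \<omega> m) \<le> 0}
      = measure_pmf.expectation P (\<lambda>x. measure (stream_space (measure_pmf P)) {\<omega>. \<exists>m\<le>n. fst (walk_pos (z + x) \<omega> m) \<le> 0})"
      using False by (subst measure_first_step[OF P]) (auto simp: ex_le_Suc_shift walk_pos_Stream)
    also have "\<dots> \<le> measure_pmf.expectation P (\<lambda>x. exp (- \<theta> * real_of_int (fst (z + x))) * r ^ n)"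
      by (intro integral_mono integrable_measure_pmf_finite P Suc)
    also have "\<dots> = exp (- \<theta> * real_of_int (fst z)) * r ^ n * measure_pmf.expectation P (\<lambda>x. exp (- \<theta> * real_of_int (fst x)))"
      proof -
      have "exp (- \<theta> * real_of_int (fst (z + x))) * r ^ n
        = exp (- \<theta> * real_of_int (fst z)) * r ^ n * exp (- \<theta> * real_of_int (fst x))" for x
        by (simp add: distrib_left exp_diff exp_minus field_simps)
      then show ?thesis by (simp only: integral_mult_right_zero)
    qed
    also have "\<dots> \<le> exp (- \<theta> * real_of_int (fst z)) * r ^ n * r"
      using r r' by (intro mult_left_mono) auto
    finally show ?thesis by (simp add: mult_ac)
  qed
qed

text \<open>Chernoff's bound at the single time \<open>n\<close>; here \<open>r\<close> may lie
  below 1, which makes the bound decay in \<open>n\<close>.\<close>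

lemma prob_first_coordinate_positive_le:
  fixes P :: "(int \<times> int) pmf" and \<theta> :: real
  assumes P: "finite (set_pmf P)" and \<theta>: "0 \<le> \<theta>"
    and r: "measure_pmf.expectation P (\<lambda>x. exp (\<theta> * real_of_int (fst x))) \<le> r"
  shows "measure (stream_space (measure_pmf P)) {\<omega>. 0 < fst (walk_pos z \<omega> n)} \<le> exp (\<theta> * real_of_int (fst z)) * r ^ n"
proof (induction n arbitrary: z)
  case 0
  then show ?case using \<theta> prob_space.prob_space[OF prob_space_stream_pmf[of P]] by simp
next
  case (Suc n)
  have "0 \<le> measure_pmf.expectation P (\<lambda>x. exp (\<theta> * real_of_int (fst x)))" by simp
  with r have r0: "0 \<le> r" by linarith
  have "measure (stream_space (measure_pmf P)) {\<omega>. 0 < fst (walk_pos z \<omega> (Suc n))}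
    = measure_pmf.expectation P (\<lambda>x. measure (stream_space (measure_pmf P)) {\<omega>. 0 < fst (walk_pos (z + x) \<omega> n)})"
    by (subst measure_first_step[OF P]) (auto simp: walk_pos_Stream)
  also have "\<dots> \<le> measure_pmf.expectation P (\<lambda>x. exp (\<theta> * real_of_int (fst (z + x))) * r ^ n)"
    by (intro integral_mono integrable_measure_pmf_finite P Suc)
  also have "\<dots> = exp (\<theta> * real_of_int (fst z)) * r ^ n * measure_pmf.expectation P (\<lambda>x. exp (\<theta> * real_of_int (fst x)))"
    by (subst integral_mult_right_zero[symmetric]) (simp add: distrib_left exp_add mult_ac)
  also have "\<dots> \<le> exp (\<theta> * real_of_int (fst z)) * r ^ n * r"
    using r r0 by (intro mult_left_mono) auto
  finally show ?case by (simp add: mult_ac)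
qed

lemma exp_le_quadratic:
  fixes x :: real
  assumes "\<bar>x\<bar> \<le> 1"
  shows "exp x \<le> 1 + x + x\<^sup>2"
proof (cases "x \<ge> 0")
  case True
  then show ?thesis using exp_bound[of x] assms by simp
next
  case False
  \<comment> \<open>The product equals \<open>1 - x ^ 3\<close>. It is combined with
    \<open>1 - x \<le> exp (- x)\<close>.\<close>
  have "1 \<le> (1 - x) * (1 + x + x\<^sup>2)"
    using False by (simp add: algebra_simps power2_eq_square mult_nonpos_nonneg)
  moreover have "0 \<le> 1 + x + x\<^sup>2" using False assms by (simp add: abs_if)
  ultimately have "1 \<le> exp (- x) * (1 + x + x\<^sup>2)"
    using exp_ge_add_one_self[of "- x"] by (smt (verit) mult_right_mono)
  then show ?thesis by (simp add: exp_minus field_simps)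
qed

text \<open>The second moment of a unit step is at most 1, which bounds the quadratic term; for
  small \<open>t\<close> of the right sign the drift term dominates it.\<close>

lemma mgf_unit_step_le:
  assumes R: "set_pmf R \<subseteq> {-1..1}" and t: "\<bar>t\<bar> \<le> 1"
  shows "measure_pmf.expectation R (\<lambda>k. exp (t * real_of_int k))
     \<le> exp (t * measure_pmf.expectation R real_of_int + t\<^sup>2)"
proof -
  have p0: "pmf R 0 = 1 - pmf R 1 - pmf R (-1)"
    using expectation_unit_step[OF R, of "\<lambda>_. 1"] by simp
  have "measure_pmf.expectation R (\<lambda>k. exp (t * real_of_int k))
     \<le> (1 - t + t\<^sup>2) * pmf R (-1) + 1 * pmf R 0 + (1 + t + t\<^sup>2) * pmf R 1"
    unfolding expectation_unit_step[OF R]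
    using exp_le_quadratic[of t] exp_le_quadratic[of "- t"] t
    by (intro add_mono mult_right_mono) auto
  also have "\<dots> = 1 + t * measure_pmf.expectation R real_of_int + t\<^sup>2 * (1 - pmf R 0)"
    unfolding expectation_unit_step[OF R] by (simp add: p0 algebra_simps)
  also have "\<dots> \<le> 1 + (t * measure_pmf.expectation R real_of_int + t\<^sup>2)"
    by (simp add: algebra_simps)
  also have "\<dots> \<le> exp (t * measure_pmf.expectation R real_of_int + t\<^sup>2)"
    by (rule exp_ge_add_one_self)
  finally show ?thesis .
qed

section \<open>Pathwise comparison of the hitting event with events of single coordinates\<close>

context
  fixes \<omega> :: "(int \<times> int) stream" and z :: "int \<times> int"
  assumes steps: "\<omega> !! n \<in> {-1..1} \<times> {-1..1}"
    and start: "fst z > 0" "snd z > 0"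
begin

text \<open>Coordinates change by at most 1 per step, so the walk cannot leave the open quadrant
  without landing on the boundary.\<close>

lemma walk_pos_interior:
  "(\<forall>m\<le>n. \<not> on_boundary (walk_pos z \<omega> m)) \<Longrightarrow> fst (walk_pos z \<omega> n) > 0 \<and> snd (walk_pos z \<omega> n) > 0"
proof (induction n)
  case (Suc n)
  then have "fst (walk_pos z \<omega> n) > 0 \<and> snd (walk_pos z \<omega> n) > 0" by simp
  moreover have "\<not> on_boundary (walk_pos z \<omega> (Suc n))" using Suc by blast
  ultimately show ?case
    using steps[of n] by (auto simp: walk_pos_Suc on_boundary_def mem_Times_iff)
qed (use start in auto)

text \<open>Either the hit occurs by time \<open>N\<close>, and then the first coordinate is 0 at
  that moment, or the walk is still in the interior throughout the first \<open>N\<close>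
  steps.\<close>

lemma hits_V_imp:
  assumes "hits_V_before_Hstar z \<omega>"
  shows "(\<forall>m\<le>N. 0 < snd (walk_pos z \<omega> m)) \<or> (\<exists>m\<le>N. fst (walk_pos z \<omega> m) \<le> 0)"
proof -
  from assms obtain n where n: "fst (walk_pos z \<omega> n) = 0" "\<forall>m<n. \<not> on_boundary (walk_pos z \<omega> m)"
    by (auto simp: hits_V_before_Hstar_def)
  show ?thesis
  proof (cases "n \<le> N")
    case True
    then show ?thesis using n by force
  next
    case False
    then show ?thesis using n walk_pos_interior by simp
  qed
qed

text \<open>At the first time with nonpositive first coordinate, unit steps force this coordinate to
  be exactly 0, while the second one is still positive.\<close>

lemma hits_V_if:
  assumes pos: "\<forall>m\<le>N. 0 < snd (walk_pos z \<omega> m)" and "fst (walk_pos z \<omega> N) \<le> 0"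
  shows "hits_V_before_Hstar z \<omega>"
proof -
  define n where "n = (LEAST n. fst (walk_pos z \<omega> n) \<le> 0)"
  have n: "fst (walk_pos z \<omega> n) \<le> 0" "n \<le> N"
    unfolding n_def using assms(2) by (auto intro: LeastI Least_le)
  have less: "0 < fst (walk_pos z \<omega> m)" if "m < n" for m
    using not_less_Least[of m "\<lambda>n. fst (walk_pos z \<omega> n) \<le> 0"] that unfolding n_def by simp
  obtain k where k: "n = Suc k" using n(1) start by (cases n) auto
  have "fst (walk_pos z \<omega> n) = 0"
    using n(1) less[of k] steps[of k] by (auto simp: k walk_pos_Suc mem_Times_iff)
  moreover have "\<not> on_boundary (walk_pos z \<omega> m)" if "m < n" for m
    using less[OF that] pos[rule_format, of m] n(2) that by (auto simp: on_boundary_def)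
  ultimately show ?thesis
    using pos n(2) unfolding hits_V_before_Hstar_def by (intro exI[of _ n]) (auto simp: less_imp_le)
qed

end

section \<open>Squeezing the hitting probability between survival probabilities of Y\<close>

theorem theorem4:
  fixes P :: "(int \<times> int) pmf"
  assumes supp: "set_pmf P \<subseteq> {-1..1} \<times> {-1..1}"
    and H2: "\<forall>n < 6. \<not> (let L = [pmf P (1,1), pmf P (1,0), pmf P (1,-1), pmf P (0,-1),
                                pmf P (-1,-1), pmf P (-1,0), pmf P (-1,1), pmf P (0,1)]
                        in L ! n = 0 \<and> L ! (n+1) = 0 \<and> L ! (n+2) = 0)"
    and H3: "pmf P (1,1) + pmf P (-1,1) + pmf P (-1,-1) + pmf P (1,-1) < 1"
    and drift_x: "(\<Sum>k\<in>{-1..1::int}. \<Sum>l\<in>{-1..1::int}. real_of_int k * pmf P (k,l)) < 0"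
    and drift_y: "(\<Sum>k\<in>{-1..1::int}. \<Sum>l\<in>{-1..1::int}. real_of_int l * pmf P (k,l)) = 0"
  shows "\<exists>D::real. 0 < D \<and>
           (\<forall>j0::int. j0 \<ge> 1 \<longrightarrow>
              (\<lambda>i0::nat. hit_prob P (int i0) j0)
                \<sim>[at_top] (\<lambda>i0::nat. D * real_of_int j0 / sqrt (real i0)))"
proof -
  let ?M = "stream_space (measure_pmf P)"
  let ?X = "map_pmf fst P" and ?Y = "map_pmf snd P"
  interpret M: prob_space ?M by (rule prob_space_stream_pmf)
  have fin: "finite (set_pmf P)" using supp by (rule finite_subset) simp
  have X: "set_pmf ?X \<subseteq> {-1..1}" and Y: "set_pmf ?Y \<subseteq> {-1..1}" using supp by auto
  have E: "measure_pmf.expectation P f = (\<Sum>k\<in>{-1..1::int}. \<Sum>l\<in>{-1..1::int}. f (k, l) * pmf P (k, l))"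
    for f :: "int \<times> int \<Rightarrow> real"
    using supp by (subst integral_measure_pmf_real[of "{-1..1} \<times> {-1..1}"])
      (auto simp: sum.cartesian_product case_prod_unfold)
  define \<mu> where "\<mu> = - measure_pmf.expectation ?X real_of_int"
  have \<mu>: "\<mu> > 0" using drift_x E[of "\<lambda>x. real_of_int (fst x)"] by (simp add: \<mu>_def)
  have "measure_pmf.expectation ?X (\<lambda>_. 1::real) = 1" by simp
  then have "pmf ?X (-1) + pmf ?X 0 + pmf ?X 1 = 1"
    using expectation_unit_step[OF X, of "\<lambda>_. 1"] by simp
  then have \<mu>1: "\<mu> \<le> 1"
    unfolding \<mu>_def expectation_unit_step[OF X] by simp (smt (verit) pmf_nonneg)
  define q where "q = pmf ?Y 1"
  have "measure_pmf.expectation ?Y real_of_int = 0"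
    using drift_y E[of "\<lambda>x. real_of_int (snd x)"] by simp
  then have q': "pmf ?Y (-1) = q"
    unfolding expectation_unit_step[OF Y] by (simp add: q_def)
  have "measure_pmf.expectation ?Y (\<lambda>_. 1::real) = 1" by simp
  then have "q + pmf ?Y 0 + q = 1"
    unfolding expectation_unit_step[OF Y] q' by (simp add: q_def)
  then have q_le: "q \<le> 1 / 2" using pmf_nonneg[of ?Y 0] by linarith
  \<comment> \<open>Otherwise no jump goes down, and entries 2, 3, 4 of the list in
    \<open>H2\<close>, the three with second coordinate -1, all vanish.\<close>
  have q: "q > 0"
  proof (rule ccontr)
    assume "\<not> q > 0"
    then have "pmf ?Y (-1) = 0" using q' pmf_nonneg[of ?Y 1] by (simp add: q_def)
    then have "-1 \<notin> snd ` set_pmf P" by (simp add: pmf_eq_0_set_pmf)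
    then have "pmf P (k, -1) = 0" for k by (force simp: pmf_eq_0_set_pmf)
    then show False using H2[rule_format, of 2] by (simp add: Let_def)
  qed
  have mgf: "measure_pmf.expectation P (\<lambda>x. exp (t * real_of_int (fst x))) \<le> exp (- t * \<mu> + t\<^sup>2)"
    if "\<bar>t\<bar> \<le> 1" for t
    using mgf_unit_step_le[OF X that] by (simp add: \<mu>_def)
  \<comment> \<open>Streams with larger jumps exist but form a null set; the pathwise lemmas
    therefore apply almost everywhere.\<close>
  have AE_steps: "AE \<omega> in ?M. \<forall>n. \<omega> !! n \<in> {-1..1} \<times> {-1..1}"
  proof -
    have "AE \<omega> in ?M. stream_all (\<lambda>x. x \<in> {-1..1} \<times> {-1..1}) \<omega>"
      using supp by (intro prob_space.AE_stream_all[OF measure_pmf.prob_space_axioms]) (auto simp: AE_measure_pmf_iff)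
    then show ?thesis by (auto simp: sset_range elim!: eventually_mono)
  qed
  have A: "{\<omega>. \<forall>m\<le>N. 0 < snd (walk_pos z \<omega> m)} \<in> sets ?M" for z N
  proof -
    have "Measurable.pred ?M (\<lambda>\<omega>. \<forall>m\<le>N. 0 < snd (walk_pos z \<omega> m))" by measurable
    then show ?thesis by (simp add: pred_def)
  qed
  have B: "{\<omega>. \<exists>m\<le>N. fst (walk_pos z \<omega> m) \<le> 0} \<in> sets ?M" for z N
  proof -
    have "Measurable.pred ?M (\<lambda>\<omega>. \<exists>m\<le>N. fst (walk_pos z \<omega> m) \<le> 0)" by measurable
    then show ?thesis by (simp add: pred_def)
  qed
  have C: "{\<omega>. 0 < fst (walk_pos z \<omega> N)} \<in> sets ?M" for z N
    using pred_walk_pos[where R = "\<lambda>x. 0 < fst x"] by (simp add: pred_def)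
  have H: "{\<omega>. hits_V_before_Hstar z \<omega>} \<in> sets ?M" for z
    using pred_hits_V[where P = P and z = z] by (simp add: pred_def)
  \<comment> \<open>By \<open>hits_V_imp\<close>, a hit means that Y survives up to \<open>N\<close>
    or that X is early; the exponential term bounds the latter, with the moment generating function
    at \<open>- t\<close>.\<close>
  have upper: "hit_prob P i j \<le> surv q N j + exp (- t * i) * exp (t * \<mu> + t\<^sup>2) ^ N"
    if "i \<ge> 1" "j \<ge> 1" "0 \<le> t" "t \<le> 1" for i j t N
  proof -
    have "AE \<omega> in ?M. hits_V_before_Hstar (i, j) \<omega> \<longrightarrow>
       (\<forall>m\<le>N. 0 < snd (walk_pos (i, j) \<omega> m)) \<or> (\<exists>m\<le>N. fst (walk_pos (i, j) \<omega> m) \<le> 0)"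
      using AE_steps
    proof eventually_elim
      case (elim \<omega>)
      then show ?case using hits_V_imp[of \<omega> "(i, j)" N] that by simp
    qed
    then have "hit_prob P i j \<le> measure ?M ({\<omega>. \<forall>m\<le>N. 0 < snd (walk_pos (i, j) \<omega> m)}
        \<union> {\<omega>. \<exists>m\<le>N. fst (walk_pos (i, j) \<omega> m) \<le> 0})"
      unfolding hit_prob_def by (intro M.finite_measure_mono_AE sets.Un A B) simp
    also have "\<dots> \<le> measure ?M {\<omega>. \<forall>m\<le>N. 0 < snd (walk_pos (i, j) \<omega> m)}
        + measure ?M {\<omega>. \<exists>m\<le>N. fst (walk_pos (i, j) \<omega> m) \<le> 0}"
      by (intro measure_Un_le A B)
    also have "\<dots> \<le> surv q N j + exp (- t * i) * exp (t * \<mu> + t\<^sup>2) ^ N"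
      using prob_second_coordinate_positive[OF fin Y, of q N "(i, j)"] q'
        prob_first_coordinate_nonpos_le[OF fin, of t "exp (t * \<mu> + t\<^sup>2)" N "(i, j)"] mgf[of "- t"] that \<mu>
      by (simp add: q_def)
    finally show ?thesis .
  qed
  \<comment> \<open>By \<open>hits_V_if\<close>, survival of Y up to \<open>N\<close> gives a hit
    unless X is late, that is, still positive at time \<open>N\<close>.\<close>
  have lower: "surv q N j - exp (t * i) * exp (- t * \<mu> + t\<^sup>2) ^ N \<le> hit_prob P i j"
    if "i \<ge> 1" "j \<ge> 1" "0 \<le> t" "t \<le> 1" for i j t N
  proof -
    have "AE \<omega> in ?M. (\<forall>m\<le>N. 0 < snd (walk_pos (i, j) \<omega> m)) \<longrightarrow>
       hits_V_before_Hstar (i, j) \<omega> \<or> 0 < fst (walk_pos (i, j) \<omega> N)"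
      using AE_steps
    proof eventually_elim
      case (elim \<omega>)
      then show ?case using hits_V_if[of \<omega> "(i, j)" N] that by auto
    qed
    then have "measure ?M {\<omega>. \<forall>m\<le>N. 0 < snd (walk_pos (i, j) \<omega> m)} \<le>
      measure ?M ({\<omega>. hits_V_before_Hstar (i, j) \<omega>} \<union> {\<omega>. 0 < fst (walk_pos (i, j) \<omega> N)})"
      by (intro M.finite_measure_mono_AE sets.Un H C) simp
    also have "\<dots> \<le> hit_prob P i j + measure ?M {\<omega>. 0 < fst (walk_pos (i, j) \<omega> N)}"
      unfolding hit_prob_def by (intro measure_Un_le H C)
    also have "\<dots> \<le> hit_prob P i j + exp (t * i) * exp (- t * \<mu> + t\<^sup>2) ^ N"
      using prob_first_coordinate_positive_le[OF fin, of t "exp (- t * \<mu> + t\<^sup>2)" "(i, j)" N] mgf[of t] that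
      by simp
    finally show ?thesis
      using prob_second_coordinate_positive[OF fin Y, of q N "(i, j)"] q' by (simp add: q_def)
  qed
  let ?c = "sqrt (2 / pi) / sqrt (2 * q)"
  have lim: "(\<lambda>i. hit_prob P (int i) (int j) * sqrt i) \<longlonglongrightarrow> j * ?c / sqrt (1 / \<mu>)" if "j \<ge> 1" for j :: nat
  proof (rule sqrt_squeeze[where f = "\<lambda>n. surv q n (int j)" and g = "\<lambda>i. hit_prob P (int i) (int j)",
        OF surv_limit[OF q q_le]])
    fix \<epsilon> :: real assume \<epsilon>: "0 < \<epsilon>" "\<epsilon> < 1"
    \<comment> \<open>With this choice \<open>t\<^sup>2\<close> is the fraction
      \<open>\<epsilon> / 4\<close> of the drift term \<open>t * \<mu>\<close>, while the horizon is
      off by the fraction \<open>\<epsilon>\<close>. At least \<open>\<epsilon> / 2\<close> of the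
      gain remains, whence the rate \<open>t * \<epsilon> / 2\<close> in both directions.\<close>
    define t where "t = \<epsilon> * \<mu> / 4"
    have t: "0 < t" "t \<le> 1" "t < \<mu>"
      using \<epsilon> \<mu> \<mu>1 mult_strict_mono[of \<epsilon> 1 \<mu> 2] by (auto simp: t_def)
    define N M where "N i = nat \<lfloor>(1 - \<epsilon>) * (1 / \<mu>) * i\<rfloor>" and "M i = nat \<lfloor>(1 + \<epsilon>) * (1 / \<mu>) * i\<rfloor>" for i :: nat
    have N: "exp (- t * i) * exp (t * \<mu> + t\<^sup>2) ^ N i \<le> 1 * exp (- (t * \<epsilon> / 2) * i)"
      for i :: nat
    proof -
      have "real (N i) \<le> (1 - \<epsilon>) * (1 / \<mu>) * i"
        using \<epsilon> \<mu> unfolding N_def by (intro of_nat_floor) auto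
      then have "real (N i) * (t * \<mu> + t\<^sup>2) \<le> (1 - \<epsilon>) * (1 / \<mu>) * i * (t * \<mu> + t\<^sup>2)"
        using t \<mu> by (intro mult_right_mono) auto
      also have "\<dots> = t * i * ((1 - \<epsilon>) * (1 + \<epsilon> / 4))"
        using \<mu> by (simp add: t_def field_simps power2_eq_square)
      also have "\<dots> \<le> t * i * (1 - \<epsilon> / 2)"
        using \<epsilon> t by (intro mult_left_mono) (auto simp: algebra_simps)
      finally show ?thesis
        by (simp add: exp_add[symmetric] exp_of_nat_mult[symmetric] algebra_simps)
    qed
    \<comment> \<open>The factor \<open>exp (t * \<mu>)\<close> pays for rounding down: the horizon
      can lose up to one step, and the exponent per step is negative.\<close>
    have M: "exp (t * i) * exp (- t * \<mu> + t\<^sup>2) ^ M i \<le> exp (t * \<mu>) * exp (- (t * \<epsilon> / 2) * i)"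
      for i :: nat
    proof -
      have "(1 + \<epsilon>) * (1 / \<mu>) * i - 1 \<le> M i"
        unfolding M_def by linarith
      then have "real (M i) * (t * (t - \<mu>)) \<le> ((1 + \<epsilon>) * (1 / \<mu>) * i - 1) * (t * (t - \<mu>))"
        using t by (intro mult_right_mono_neg) (auto simp: mult_nonneg_nonpos)
      also have "\<dots> = t * i * ((1 + \<epsilon>) * (\<epsilon> / 4 - 1)) - t\<^sup>2 + t * \<mu>"
        using \<mu> by (simp add: t_def field_simps power2_eq_square)
      also have "\<dots> \<le> t * i * (- 1 - \<epsilon> / 2) + t * \<mu>"
      proof -
        have "(1 + \<epsilon>) * (\<epsilon> / 4 - 1) \<le> - 1 - \<epsilon> / 2"
          using \<epsilon> mult_left_mono[of \<epsilon> 1 \<epsilon>] by (simp add: algebra_simps)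
        then have "t * i * ((1 + \<epsilon>) * (\<epsilon> / 4 - 1)) \<le> t * i * (- 1 - \<epsilon> / 2)"
          using t by (intro mult_left_mono) auto
        then show ?thesis by (smt (verit) zero_le_power2)
      qed
      finally show ?thesis
        by (simp add: exp_add[symmetric] exp_of_nat_mult[symmetric] algebra_simps power2_eq_square)
    qed
    show "\<exists>C c::real. c > 0 \<and> (\<forall>\<^sub>F i in sequentially. hit_prob P (int i) (int j)
        \<le> surv q (nat \<lfloor>(1 - \<epsilon>) * (1 / \<mu>) * i\<rfloor>) (int j) + C * exp (- c * i))"
      unfolding N_def[symmetric]
    proof (intro exI conjI)
      show "\<forall>\<^sub>F i in sequentially. hit_prob P (int i) (int j)
        \<le> surv q (N i) (int j) + 1 * exp (- (t * \<epsilon> / 2) * i)"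
        using eventually_ge_at_top[of 1]
      proof eventually_elim
        case (elim i)
        then have "hit_prob P (int i) (int j) \<le> surv q (N i) (int j) + exp (- t * i) * exp (t * \<mu> + t\<^sup>2) ^ N i"
          using upper[of "int i" "int j" t "N i"] t that by simp
        with N[of i] show ?case by linarith
      qed
    qed (use t \<epsilon> in simp)
    show "\<exists>C c::real. c > 0 \<and> (\<forall>\<^sub>F i in sequentially. surv q (nat \<lfloor>(1 + \<epsilon>) * (1 / \<mu>) * i\<rfloor>) (int j)
        - C * exp (- c * i) \<le> hit_prob P (int i) (int j))"
      unfolding M_def[symmetric]
    proof (intro exI conjI)
      show "\<forall>\<^sub>F i in sequentially. surv q (M i) (int j)
        - exp (t * \<mu>) * exp (- (t * \<epsilon> / 2) * i) \<le> hit_prob P (int i) (int j)"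
        using eventually_ge_at_top[of 1]
      proof eventually_elim
        case (elim i)
        then have "surv q (M i) (int j) - exp (t * i) * exp (- t * \<mu> + t\<^sup>2) ^ M i \<le> hit_prob P (int i) (int j)"
          using lower[of "int i" "int j" t "M i"] t that by simp
        with M[of i] show ?case by linarith
      qed
    qed (use t \<epsilon> in simp)
  qed (use \<mu> in auto)
  \<comment> \<open>This is \<open>sqrt (\<mu> / (pi * q))\<close>, the same for all starting
    heights.\<close>
  define D where "D = ?c / sqrt (1 / \<mu>)"
  have D: "D > 0" using q \<mu> by (simp add: D_def)
  have "(\<lambda>i0::nat. hit_prob P (int i0) j0) \<sim>[at_top] (\<lambda>i0. D * real_of_int j0 / sqrt (real i0))"
    if "j0 \<ge> 1" for j0
  proof (rule asymp_equivI')
    define j where "j = nat j0"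
    have j: "j0 = int j" "j \<ge> 1" using that by (auto simp: j_def)
    have eq: "j * ?c / sqrt (1 / \<mu>) = D * j" by (simp add: D_def)
    have "(\<lambda>i. hit_prob P (int i) j0 * sqrt i) \<longlonglongrightarrow> D * j"
      using lim[OF j(2)] by (simp only: eq j(1))
    then have "(\<lambda>i. hit_prob P (int i) j0 * sqrt i / (D * j)) \<longlonglongrightarrow> D * j / (D * j)"
      by (rule tendsto_divide[OF _ tendsto_const]) (use D j in auto)
    then show "(\<lambda>i. hit_prob P (int i) j0 / (D * real_of_int j0 / sqrt (real i))) \<longlonglongrightarrow> 1"
      using D j by simp
  qed
  with D show ?thesis by blast
qed

end
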